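(* Let $n>2$, let $(G,f)$ be an $n$-ary group with a central element $e$, and let $\Lambda_1, \Lambda_2:G\rightarrow GL(V)$ be two representations of $(G,f)$ such that $\hat{\Lambda}_1\sim \hat{\Lambda}_2$, where $\hat\Lambda_i$ denotes the representation of the retract $\hat G=Ret_e(G,f)$ given by $\hat{\Lambda}_i(x)=\Lambda_i(e)^{n-2}\Lambda_i(x)$. Then $\Lambda_1\sim \Lambda_2$ if and only if $\ker \Lambda_1=\ker \Lambda_2$.
   Context: An $n$-ary group ($n>2$) is a non-empty set $G$ with an operation $f:G^n\to G$ that is associative, i.e. $f(x_1,\ldots,x_{i-1},f(x_i,\ldots,x_{n+i-1}),x_{n+i},\ldots,x_{2n-1})$ does not depend on $i\in\{1,\ldots,n\}$, and such that for every $i$ the equation $f(x_1,\ldots,x_{i-1},z,x_{i+1},\ldots,x_n)=x_0$ has a unique solution $z\in G$ for all given elements. The symbol $\stackrel{(t)}{x}$ denotes $x$ repeated $t$ times. The skew element $\overline{x}$ of $x$ is the unique $z$ with $f(\stackrel{(n-1)}{x},z)=x$. An element $e\in G$ is central if for all $x_2,\ldots,x_n\in G$ the value of $f$ on the sequence obtained by inserting $e$ into $x_2,\ldots,x_n$ is independent of the position at which $e$ is inserted: $f(e,x_2,\ldots,x_n)=f(x_2,e,x_3,\ldots,x_n)=\cdots=f(x_2,\ldots,x_n,e)$. The retract $Ret_e(G,f)$ is the set $G$ with binary operation $x\ast y=f(x,\stackrel{(n-2)}{e},y)$; it is a group with identity $\overline{e}$. All vector spaces are finite dimensional over $\mathbb{C}$.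 A representation of $(G,f)$ is a map $\Lambda:G\to GL(V)$ with $\Lambda(f(x_1,\ldots,x_n))=\Lambda(x_1)\cdots\Lambda(x_n)$ for all $x_i\in G$ such that $\ker\Lambda=\{x\in G:\Lambda(x)=\mathrm{id}\}$ is non-empty. For such $\Lambda$, the map $\hat\Lambda(x)=\Lambda(e)^{n-2}\Lambda(x)$ is an ordinary representation of the group $Ret_e(G,f)$. The symbol $\sim$ denotes equivalence of representations: $\Lambda_1\sim\Lambda_2$ means there is an invertible linear map $T$ with $\Lambda_2(x)=T\Lambda_1(x)T^{-1}$ for all $x$ (similarly for $\hat\Lambda_1\sim\hat\Lambda_2$). *)

theory Defs
  imports Complex_Main "HOL-Algebra.Group"
begin

text \<open>
  The arguments of an \<open>n\<close>-ary operation are given as a list; only lists of length \<open>n\<close> with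
  entries in the carrier matter.
\<close>

definition insert_at :: "nat \<Rightarrow> 'a \<Rightarrow> 'a list \<Rightarrow> 'a list" where
  "insert_at i z xs = take i xs @ z # drop i xs"

locale nary_group =
  fixes n :: nat and G :: "'g set" and f :: "'g list \<Rightarrow> 'g"
  assumes arity: "n > 2"
    and nonempty: "G \<noteq> {}"
    and closed: "\<lbrakk>length xs = n; set xs \<subseteq> G\<rbrakk> \<Longrightarrow> f xs \<in> G"
    and assoc: "\<lbrakk>length xs = 2 * n - 1; set xs \<subseteq> G; i < n; j < n\<rbrakk> \<Longrightarrow>
      f (take i xs @ [f (take n (drop i xs))] @ drop (i + n) xs) =
      f (take j xs @ [f (take n (drop j xs))] @ drop (j + n) xs)"
    and solvable: "\<lbrakk>length xs = n - 1; set xs \<subseteq> G; x0 \<in> G; i < n\<rbrakk> \<Longrightarrow>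
      \<exists>!z. z \<in> G \<and> f (insert_at i z xs) = x0"

definition skew :: "nat \<Rightarrow> 'g set \<Rightarrow> ('g list \<Rightarrow> 'g) \<Rightarrow> 'g \<Rightarrow> 'g" where
  "skew n G f x = (THE z. z \<in> G \<and> f (replicate (n - 1) x @ [z]) = x)"

definition central :: "nat \<Rightarrow> 'g set \<Rightarrow> ('g list \<Rightarrow> 'g) \<Rightarrow> 'g \<Rightarrow> bool" where
  "central n G f e \<longleftrightarrow> e \<in> G \<and>
     (\<forall>xs i j. length xs = n - 1 \<and> set xs \<subseteq> G \<and> i < n \<and> j < n \<longrightarrow>
        f (insert_at i e xs) = f (insert_at j e xs))"

definition retract :: "nat \<Rightarrow> 'g set \<Rightarrow> ('g list \<Rightarrow> 'g) \<Rightarrow> 'g \<Rightarrow> 'g monoid" where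
  "retract n G f e =
     \<lparr>carrier = G, mult = (\<lambda>x y. f (x # replicate (n - 2) e @ [y])), one = skew n G f e\<rparr>"

text \<open>
  A vector space is given by its scalar multiplication on a whole type; the zero space is not
  excluded.
\<close>

definition GL :: "(complex \<Rightarrow> 'v::ab_group_add \<Rightarrow> 'v) \<Rightarrow> ('v \<Rightarrow> 'v) monoid" where
  "GL scale = \<lparr>carrier = {T. Vector_Spaces.linear scale scale T \<and> bij T}, mult = (\<circ>), one = id\<rparr>"

definition rep_ker :: "'g set \<Rightarrow> ('g \<Rightarrow> 'v \<Rightarrow> 'v) \<Rightarrow> 'g set" where
  "rep_ker G L = {x \<in> G. L x = id}"

definition nary_rep ::
  "nat \<Rightarrow> 'g set \<Rightarrow> ('g list \<Rightarrow> 'g) \<Rightarrow> (complex \<Rightarrow> 'v::ab_group_add \<Rightarrow> 'v) \<Rightarrow>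
     ('g \<Rightarrow> 'v \<Rightarrow> 'v) \<Rightarrow> bool" where
  "nary_rep n G f scale L \<longleftrightarrow>
     L \<in> G \<rightarrow> carrier (GL scale) \<and>
     (\<forall>xs. length xs = n \<and> set xs \<subseteq> G \<longrightarrow> L (f xs) = foldr (\<circ>) (map L xs) id) \<and>
     rep_ker G L \<noteq> {}"

definition hat_rep :: "nat \<Rightarrow> 'g \<Rightarrow> ('g \<Rightarrow> 'v \<Rightarrow> 'v) \<Rightarrow> 'g \<Rightarrow> 'v \<Rightarrow> 'v" where
  "hat_rep n e L x = (L e ^^ (n - 2)) \<circ> L x"

text \<open>
  Equivalence on a set \<open>A\<close> of group elements: the functions are representations only on the
  carrier, so values outside it are ignored.
\<close>

definition rep_equiv ::
  "'g set \<Rightarrow> (complex \<Rightarrow> 'v::ab_group_add \<Rightarrow> 'v) \<Rightarrow>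
     ('g \<Rightarrow> 'v \<Rightarrow> 'v) \<Rightarrow> ('g \<Rightarrow> 'v \<Rightarrow> 'v) \<Rightarrow> bool" where
  "rep_equiv A scale L1 L2 \<longleftrightarrow>
     (\<exists>T \<in> carrier (GL scale). \<forall>x \<in> A. L2 x = T \<circ> L1 x \<circ> inv_into UNIV T)"

lemma (in nary_group) skew_props:
  assumes "x \<in> G"
  shows "skew n G f x \<in> G" "f (replicate (n - 1) x @ [skew n G f x]) = x"
proof -
  have "\<exists>!z. z \<in> G \<and> f (replicate (n - 1) x @ [z]) = x"
    using solvable[of "replicate (n - 1) x" x "n - 1"] assms arity
    by (auto simp: insert_at_def)
  from theI'[OF this] show "skew n G f x \<in> G" "f (replicate (n - 1) x @ [skew n G f x]) = x"
    unfolding skew_def by auto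
qed

lemma (in nary_group) retract_group:
  assumes e: "e \<in> G"
  shows "group (retract n G f e)"
proof -
  define m where "m x y = f (x # replicate (n - 2) e @ [y])" for x y
  define u where "u = skew n G f e"
  obtain k where k: "n = Suc (Suc k)" "k > 0"
    using arity by (metis Suc_lessE gr0_conv_Suc less_2_cases_iff less_SucI not_less_eq numeral_2_eq_2)
  have mG: "m x y \<in> G" if "x \<in> G" "y \<in> G" for x y
    unfolding m_def using that e arity by (intro closed) auto
  have uG: "u \<in> G" unfolding u_def by (rule skew_props(1)[OF e])
  have as: "m (m x y) z = m x (m y z)" if "x \<in> G" "y \<in> G" "z \<in> G" for x y z
    using assoc[of "x # replicate k e @ y # replicate k e @ [z]" 0 "n - 1"] that e k
    by (auto simp: m_def)
  have sr: "\<exists>!z. z \<in> G \<and> m x z = y" if "x \<in> G" "y \<in> G" for x y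
    using solvable[of "x # replicate k e" y "n - 1"] that e k
    by (auto simp: m_def insert_at_def)
  have sl: "\<exists>!z. z \<in> G \<and> m z x = y" if "x \<in> G" "y \<in> G" for x y
    using solvable[of "replicate k e @ [x]" y 0] that e k
    by (auto simp: m_def insert_at_def)
  have ru: "m x u = x" if x: "x \<in> G" for x
  proof -
    obtain w where w: "w \<in> G" "m w e = x" using sl[OF e x] by blast
    have r: "replicate k e @ [e] = e # replicate k e" by (simp add: replicate_append_same)
    have "m (m w e) u = m w (m e u)" using as[OF w(1) e uG] .
    also have "m e u = e" using skew_props(2)[OF e] k by (simp add: m_def u_def)
    finally show ?thesis using w by simp
  qed
  have lu: "m u x = x" if x: "x \<in> G" for x
  proof -
    have "m u (m u x) = m u x" using as[OF uG uG x] ru[OF uG] by simp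
    then show ?thesis using sr[OF uG mG[OF uG x]] x mG[OF uG x] by blast
  qed
  have "group \<lparr>carrier = G, mult = m, one = u\<rparr>"
  proof (rule groupI)
    fix x assume "x \<in> carrier \<lparr>carrier = G, mult = m, one = u\<rparr>"
    then show "\<exists>y\<in>carrier \<lparr>carrier = G, mult = m, one = u\<rparr>.
        y \<otimes>\<^bsub>\<lparr>carrier = G, mult = m, one = u\<rparr>\<^esub> x = \<one>\<^bsub>\<lparr>carrier = G, mult = m, one = u\<rparr>\<^esub>"
      using sl[of x u] uG by auto
  qed (simp_all add: mG uG lu as)
  then show ?thesis by (simp add: retract_def m_def[abs_def] u_def)
qed

lemma GL_group:
  fixes scale :: "complex \<Rightarrow> 'v::ab_group_add \<Rightarrow> 'v"
  assumes "vector_space scale"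
  shows "group (GL scale)"
proof -
  interpret vector_space_pair scale scale using assms by (simp add: vector_space_pair_def)
  show ?thesis
  proof (rule groupI)
    fix T assume T: "T \<in> carrier (GL scale)"
    then have "T (inv_into UNIV T x) = x" "inj T" "Vector_Spaces.linear scale scale T" for x
      by (simp_all add: GL_def bij_is_inj bij_is_surj surj_f_inv_f)
    then have "Vector_Spaces.linear scale scale (inv_into UNIV T)"
      by (auto simp: Vector_Spaces.linear_iff intro!: Hilbert_Choice.inv_f_eq)
    with T show "\<exists>S\<in>carrier (GL scale). S \<otimes>\<^bsub>GL scale\<^esub> T = \<one>\<^bsub>GL scale\<^esub>"
      by (intro bexI[of _ "inv_into UNIV T"]) (auto simp: GL_def bij_imp_bij_inv bij_is_inj)
  qed (auto simp: GL_def bij_comp o_assoc vs1.linear_id intro: Vector_Spaces.linear_compose)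
qed

lemma (in nary_group) hat_rep_hom:
  fixes scale :: "complex \<Rightarrow> 'v::ab_group_add \<Rightarrow> 'v"
  assumes vs: "vector_space scale" and e: "e \<in> G" and L: "nary_rep n G f scale L"
  shows "hat_rep n e L \<in> hom (retract n G f e) (GL scale)"
proof -
  interpret GL: group "GL scale" by (rule GL_group[OF vs])
  have LG: "L x \<in> carrier (GL scale)" if "x \<in> G" for x using L that by (auto simp: nary_rep_def)
  have comp: "S \<circ> T \<in> carrier (GL scale)"
    if "S \<in> carrier (GL scale)" "T \<in> carrier (GL scale)" for S T
    using GL.m_closed[OF that] by (simp add: GL_def)
  have pw: "L e ^^ k \<in> carrier (GL scale)" for k
  proof (induction k)
    case 0 show ?case using GL.one_closed by (simp add: GL_def id_def)
  next
    case (Suc k) then show ?case by (simp only: funpow.simps comp LG e)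
  qed
  have fr: "((\<circ>) (L e) ^^ k) S = (L e ^^ k) \<circ> S" for k S
    by (induction k) (simp_all add: o_assoc)
  have "L (f (x # replicate (n - 2) e @ [y])) = L x \<circ> (L e ^^ (n - 2)) \<circ> L y"
    if "x \<in> G" "y \<in> G" for x y
    using L that e arity unfolding nary_rep_def
    by (subst conjunct1[OF conjunct2, rule_format]) (auto simp: fr o_assoc)
  then show ?thesis
    using comp[OF pw LG]
    by (auto simp: hom_def retract_def hat_rep_def) (simp_all add: GL_def o_assoc)
qed

end

theory Submission
  imports Defs
begin

text \<open>
  Passing from \<open>\<Lambda>\<close> to the representation \<open>x \<mapsto> \<Lambda>(e)\<^sup>n\<^sup>-\<^sup>2 \<Lambda>(x)\<close> of the retract multiplies every value
  by one fixed invertible map \<open>P = \<Lambda>(e)\<^sup>n\<^sup>-\<^sup>2\<close>, so \<open>\<Lambda>\<close> can be recovered as soon as \<open>P\<close> is known.  A point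
  \<open>a\<close> of the kernel reveals it: at \<open>a\<close> the retract representation takes precisely the value \<open>P\<close>.
  If both kernels agree, one \<open>a\<close> serves both representations.  A map \<open>T\<close> that intertwines the two
  retract representations then conjugates \<open>P\<^sub>1\<close> into \<open>P\<^sub>2\<close>, and cancelling \<open>P\<^sub>2\<close> shows that the same
  \<open>T\<close> intertwines \<open>\<Lambda>\<^sub>1\<close> and \<open>\<Lambda>\<^sub>2\<close>.  This is \<open>conj_cancel_left\<close>.  Conversely, only the identity is
  conjugate to the identity, so equivalent representations have equal kernels.
\<close>

lemma rep_equiv_imp_rep_ker_eq:
  assumes "rep_equiv A scale L1 L2"
  shows "rep_ker A L1 = rep_ker A L2"
proof -
  obtain T where T: "bij T" and L2: "\<And>x. x \<in> A \<Longrightarrow> L2 x = T \<circ> L1 x \<circ> inv_into UNIV T"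
    using assms by (auto simp: rep_equiv_def GL_def)
  have conj_id: "T \<circ> S \<circ> inv_into UNIV T = id \<longleftrightarrow> S = id" for S
  proof
    assume "T \<circ> S \<circ> inv_into UNIV T = id"
    then have "T (S (inv_into UNIV T (T v))) = T v" for v by (simp add: fun_eq_iff)
    then show "S = id" using T by (simp add: fun_eq_iff bij_is_inj inj_eq)
  next
    assume "S = id"
    then show "T \<circ> S \<circ> inv_into UNIV T = id" using surj_iff[of T] T by (simp add: bij_is_surj)
  qed
  have "L1 x = id \<longleftrightarrow> L2 x = id" if "x \<in> A" for x
    unfolding L2[OF that] by (rule conj_id[symmetric])
  then show ?thesis unfolding rep_ker_def by blast
qed

text \<open>
  Evaluating at a common kernel point \<open>a\<close> gives \<open>Q = T P T\<^sup>-\<^sup>1\<close>.  Hence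
  \<open>Q L2(x) = T P L1(x) T\<^sup>-\<^sup>1 = Q (T L1(x) T\<^sup>-\<^sup>1)\<close>, and \<open>Q\<close> cancels.
\<close>

lemma conj_cancel_left:
  assumes T: "inj T" and Q: "inj Q"
    and eq: "\<And>x. x \<in> A \<Longrightarrow> Q \<circ> L2 x = T \<circ> (P \<circ> L1 x) \<circ> inv_into UNIV T"
    and a: "a \<in> A" "L1 a = id" "L2 a = id" and x: "x \<in> A"
  shows "L2 x = T \<circ> L1 x \<circ> inv_into UNIV T"
proof
  fix v
  have "Q = T \<circ> P \<circ> inv_into UNIV T" using eq[OF a(1)] a by simp
  then have "Q ((T \<circ> L1 x \<circ> inv_into UNIV T) v) = T (P (L1 x (inv_into UNIV T v)))" using T by simp
  also have "\<dots> = Q (L2 x v)" using eq[OF x] by (simp add: fun_eq_iff)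
  finally show "L2 x v = (T \<circ> L1 x \<circ> inv_into UNIV T) v" using Q by (simp add: inj_eq)
qed

theorem proposition3p24:
  fixes n :: nat and G :: "'g set" and f :: "'g list \<Rightarrow> 'g" and e :: 'g
    and scale :: "complex \<Rightarrow> 'v::ab_group_add \<Rightarrow> 'v" and Basis :: "'v set"
    and \<Lambda>\<^sub>1 \<Lambda>\<^sub>2 :: "'g \<Rightarrow> 'v \<Rightarrow> 'v"
  assumes "n > 2"
    and "nary_group n G f"
    and "central n G f e"
    and "finite_dimensional_vector_space scale Basis"
    and "nary_rep n G f scale \<Lambda>\<^sub>1"
    and "nary_rep n G f scale \<Lambda>\<^sub>2"
    and "rep_equiv (carrier (retract n G f e)) scale (hat_rep n e \<Lambda>\<^sub>1) (hat_rep n e \<Lambda>\<^sub>2)"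
  shows "rep_equiv G scale \<Lambda>\<^sub>1 \<Lambda>\<^sub>2 \<longleftrightarrow> rep_ker G \<Lambda>\<^sub>1 = rep_ker G \<Lambda>\<^sub>2"
proof
  assume "rep_equiv G scale \<Lambda>\<^sub>1 \<Lambda>\<^sub>2"
  then show "rep_ker G \<Lambda>\<^sub>1 = rep_ker G \<Lambda>\<^sub>2" by (rule rep_equiv_imp_rep_ker_eq)
next
  assume "rep_ker G \<Lambda>\<^sub>1 = rep_ker G \<Lambda>\<^sub>2"
  moreover have "rep_ker G \<Lambda>\<^sub>1 \<noteq> {}" using assms(5) by (simp add: nary_rep_def)
  ultimately obtain a where a: "a \<in> G" "\<Lambda>\<^sub>1 a = id" "\<Lambda>\<^sub>2 a = id"
    by (auto simp: rep_ker_def)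
  obtain T where TGL: "T \<in> carrier (GL scale)"
    and hat: "\<And>x. x \<in> G \<Longrightarrow>
      (\<Lambda>\<^sub>2 e ^^ (n - 2)) \<circ> \<Lambda>\<^sub>2 x = T \<circ> ((\<Lambda>\<^sub>1 e ^^ (n - 2)) \<circ> \<Lambda>\<^sub>1 x) \<circ> inv_into UNIV T"
    using assms(7) by (auto simp: rep_equiv_def retract_def hat_rep_def)
  have T: "inj T" using TGL by (simp add: GL_def bij_is_inj)
  have "e \<in> G" using assms(3) by (simp add: central_def)
  then have "\<Lambda>\<^sub>2 e \<in> carrier (GL scale)" using assms(6) by (auto simp: nary_rep_def)
  then have Q: "inj (\<Lambda>\<^sub>2 e ^^ (n - 2))" by (simp add: GL_def bij_is_inj inj_fn)
  have "\<Lambda>\<^sub>2 x = T \<circ> \<Lambda>\<^sub>1 x \<circ> inv_into UNIV T" if "x \<in> G" for x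
    using T Q hat a that
    by (rule conj_cancel_left[where A = G and a = a and P = "\<Lambda>\<^sub>1 e ^^ (n - 2)"
        and Q = "\<Lambda>\<^sub>2 e ^^ (n - 2)" and ?L1.0 = "\<Lambda>\<^sub>1" and ?L2.0 = "\<Lambda>\<^sub>2"])
  then show "rep_equiv G scale \<Lambda>\<^sub>1 \<Lambda>\<^sub>2" using TGL unfolding rep_equiv_def by blast
qed

end
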